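(* Let $p>1$ be an integer and suppose $f:\mathcal X\to\mathbb R$ is strongly smooth of order $p$ with constants $0<L_1,\dots,L_p<\infty$. Let $\eta>0$ satisfy $$0<\eta^{\frac{1}{p-1}}\le\min\left\{1,\ \frac{1}{2\sum_{m=2}^p\frac{L_m}{m!}}\right\}.$$ Then rescaled gradient descent $$x_{k+1}=x_k-\eta^{\frac{1}{p-1}}\frac{B^{-1}\nabla f(x_k)}{\|\nabla f(x_k)\|_\ast^{\frac{p-2}{p-1}}}$$ satisfies, with $\delta=\eta^{\frac{1}{p-1}}/2$, $$\frac{f(x_{k+1})-f(x_k)}{\delta}\le-\|\nabla f(x_k)\|_\ast^{\frac{p}{p-1}}\qquad\text{for all }k\ge0.$$
   Context: $\mathcal X$ (identified with $\mathbb R^d$) is a finite-dimensional real vector space with norm $\|v\|=\sqrt{\langle v,Bv\rangle}$ and dual norm $\|s\|_\ast=\sqrt{\langle s,B^{-1}s\rangle}$ on $\mathcal X^\ast$, where $B:\mathcal X\to\mathcal X^\ast$ is a positive definite self-adjoint operator. For a $p$ times differentiable $f$, $\nabla^m f(x)(h)^m=\sum_{i_1,\dots,i_m=1}^d\partial_{x_{i_1}\cdots x_{i_m}}f(x)\prod_{j=1}^m h_{i_j}$. A function $f$ is strongly smooth of order $p$ (integer $p>1$) with constants $0<L_1,\dots,L_p<\infty$ if for $m=1,\dots,p-1$ and all $x$, $|\nabla^m f(x)(B^{-1}\nabla f(x))^m|\le L_m\|\nabla f(x)\|_\ast^{m+\frac{p-m}{p-1}}$, and moreover $|\nabla^p f(x)(v)^p|\le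 L_p\|v\|^p$ for all $x,v\in\mathcal X$. If $\nabla f(x_k)=0$, the rescaled gradient step is $x_{k+1}=x_k$; equivalently $x_{k+1}=\arg\min_{x\in\mathcal X}\{\langle\nabla f(x_k),x\rangle+\frac{1}{p\eta}\|x-x_k\|^p\}$. *)

theory Defs
  imports "HOL-Analysis.Analysis"
begin

text \<open>
  The space and its dual are both identified with \<open>real ^ 'n\<close>; the duality pairing is the
  dot product, so \<open>B\<close> and its inverse are maps on \<open>real ^ 'n\<close>.
\<close>

definition pos_def_self_adjoint :: "(real ^ 'n \<Rightarrow> real ^ 'n) \<Rightarrow> bool" where
  "pos_def_self_adjoint B \<longleftrightarrow>
     linear B \<and> adjoint B = B \<and> (\<forall>v. v \<noteq> 0 \<longrightarrow> v \<bullet> B v > 0)"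

definition primal_norm :: "(real ^ 'n \<Rightarrow> real ^ 'n) \<Rightarrow> real ^ 'n \<Rightarrow> real" where
  "primal_norm B v = sqrt (v \<bullet> B v)"

definition dual_norm :: "(real ^ 'n \<Rightarrow> real ^ 'n) \<Rightarrow> real ^ 'n \<Rightarrow> real" where
  "dual_norm B s = sqrt (s \<bullet> inv B s)"

definition partial :: "'n \<Rightarrow> (real ^ 'n \<Rightarrow> real) \<Rightarrow> real ^ 'n \<Rightarrow> real" where
  "partial i f x = deriv (\<lambda>t. f (x + t *\<^sub>R axis i 1)) 0"

primrec iter_partial :: "'n list \<Rightarrow> (real ^ 'n \<Rightarrow> real) \<Rightarrow> real ^ 'n \<Rightarrow> real" where
  "iter_partial [] f = f"
| "iter_partial (i # is) f = partial i (iter_partial is f)"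

definition grad :: "(real ^ 'n \<Rightarrow> real) \<Rightarrow> real ^ 'n \<Rightarrow> real ^ 'n" where
  "grad f x = (\<chi> i. partial i f x)"

text \<open>
  In finite dimension, \<open>n + 1\<close> times (Frechet) differentiable means differentiable with all
  first partial derivatives \<open>n\<close> times differentiable. Continuity of the derivatives of
  order \<open>n\<close> is not required.
\<close>

primrec times_differentiable :: "nat \<Rightarrow> (real ^ 'n \<Rightarrow> real) \<Rightarrow> bool" where
  "times_differentiable 0 f \<longleftrightarrow> True"
| "times_differentiable (Suc n) f \<longleftrightarrow>
     (\<forall>x. f differentiable (at x)) \<and> (\<forall>i. times_differentiable n (partial i f))"

text \<open>
  \<open>deriv_form m f x h\<close> is the \<open>m\<close>-th derivative of \<open>f\<close> at \<open>x\<close> evaluated at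
  \<open>(h, \<dots>, h)\<close>; the lists of length \<open>m\<close> are the multi-indices \<open>(i\<^sub>1, \<dots>, i\<^sub>m)\<close>.
\<close>

definition deriv_form :: "nat \<Rightarrow> (real ^ 'n \<Rightarrow> real) \<Rightarrow> real ^ 'n \<Rightarrow> real ^ 'n \<Rightarrow> real" where
  "deriv_form m f x h =
     (\<Sum>is\<in>{is. length is = m}. iter_partial is f x * (\<Prod>j<m. h $ (is ! j)))"

definition strongly_smooth ::
  "(real ^ 'n \<Rightarrow> real ^ 'n) \<Rightarrow> nat \<Rightarrow> (nat \<Rightarrow> real) \<Rightarrow> (real ^ 'n \<Rightarrow> real) \<Rightarrow> bool" where
  "strongly_smooth B p L f \<longleftrightarrow>
     p > 1 \<and> times_differentiable p f \<and> (\<forall>m\<in>{1..p}. 0 < L m) \<and>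
     (\<forall>m\<in>{1..p - 1}. \<forall>x.
        \<bar>deriv_form m f x (inv B (grad f x))\<bar>
          \<le> L m * dual_norm B (grad f x) powr (real m + (real p - real m) / (real p - 1))) \<and>
     (\<forall>x v. \<bar>deriv_form p f x v\<bar> \<le> L p * primal_norm B v ^ p)"

definition rgd_step ::
  "(real ^ 'n \<Rightarrow> real ^ 'n) \<Rightarrow> nat \<Rightarrow> real \<Rightarrow> (real ^ 'n \<Rightarrow> real) \<Rightarrow> real ^ 'n \<Rightarrow> real ^ 'n" where
  "rgd_step B p \<eta> f x =
     (if grad f x = 0 then x
      else x - (\<eta> powr (1 / (real p - 1)) /
                 dual_norm B (grad f x) powr ((real p - 2) / (real p - 1))) *\<^sub>R inv B (grad f x))"

end

theory Submission
  imports Defs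
begin

text \<open>
  Along the segment from \<open>y\<close> to the next iterate, Taylor's theorem with Lagrange remainder expands
  \<open>f\<close> to order \<open>p\<close>. The step size is such that the term of order \<open>m\<close> is at most
  \<open>\<epsilon>\<^sup>m L\<^sub>m / m!\<close> times the same power \<open>p / (p - 1)\<close> of the dual norm of the gradient, where
  \<open>\<epsilon> = \<eta> powr (1 / (p - 1))\<close>, and the term of order \<open>1\<close> is exactly \<open>- \<epsilon>\<close> times that power. As
  \<open>\<epsilon> \<le> 1\<close> and \<open>\<epsilon> (L\<^sub>2 / 2! + \<dots> + L\<^sub>p / p!) \<le> 1 / 2\<close>, the orders \<open>2, \<dots>, p\<close> add up to at
  most \<open>\<epsilon> / 2\<close> times that power.
\<close>

section \<open>Taylor's theorem along a line\<close>

text \<open>\<open>partial\<close> is built on \<open>deriv\<close>, which says something only once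
  a derivative exists; the chain rule along the axis supplies it.\<close>

lemma partial_eq_derivative_axis:
  fixes g :: "real ^ 'n \<Rightarrow> real"
  assumes "(g has_derivative g') (at x)"
  shows "partial i g x = g' (axis i 1)"
proof -
  have "((\<lambda>t. x + t *\<^sub>R axis i (1::real)) has_derivative (\<lambda>t. t *\<^sub>R axis i 1)) (at 0)"
    by (auto intro!: derivative_eq_intros)
  then have "(g \<circ> (\<lambda>t. x + t *\<^sub>R axis i 1) has_derivative g' \<circ> (\<lambda>t. t *\<^sub>R axis i 1)) (at 0)"
    using assms by (intro diff_chain_at) simp_all
  then have "((\<lambda>t. g (x + t *\<^sub>R axis i 1)) has_derivative (*) (g' (axis i 1))) (at 0)"
    using linear_scale[OF has_derivative_linear[OF assms]]
    by (simp add: o_def mult_commute_abs)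
  then show ?thesis
    unfolding partial_def by (intro DERIV_imp_deriv) (simp add: has_field_derivative_def)
qed

lemma has_real_derivative_along_line:
  fixes g :: "real ^ 'n \<Rightarrow> real"
  assumes "g differentiable (at (y + t *\<^sub>R h))"
  shows "((\<lambda>t. g (y + t *\<^sub>R h)) has_real_derivative
           (\<Sum>i\<in>UNIV. partial i g (y + t *\<^sub>R h) * h $ i)) (at t)"
proof -
  obtain g' where g': "(g has_derivative g') (at (y + t *\<^sub>R h))"
    using assms by (auto simp: differentiable_def)
  have lin: "linear g'"
    using g' by (rule has_derivative_linear)
  have "((\<lambda>t. y + t *\<^sub>R h) has_derivative (\<lambda>s. s *\<^sub>R h)) (at t)"
    by (auto intro!: derivative_eq_intros)
  then have "(g \<circ> (\<lambda>t. y + t *\<^sub>R h) has_derivative g' \<circ> (\<lambda>s. s *\<^sub>R h)) (at t)"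
    using g' by (intro diff_chain_at) simp_all
  then have "((\<lambda>t. g (y + t *\<^sub>R h)) has_real_derivative g' h) (at t)"
    using linear_scale[OF lin]
    by (simp add: has_field_derivative_def o_def mult_commute_abs)
  moreover have "g' h = (\<Sum>i\<in>UNIV. partial i g (y + t *\<^sub>R h) * h $ i)"
  proof -
    have "g' h = g' (\<Sum>i\<in>UNIV. h $ i *\<^sub>R axis i 1)"
      using basis_expansion[of h] by (simp add: scalar_mult_eq_scaleR)
    also have "\<dots> = (\<Sum>i\<in>UNIV. partial i g (y + t *\<^sub>R h) * h $ i)"
      by (simp add: linear_sum[OF lin] linear_scale[OF lin] partial_eq_derivative_axis[OF g']
          mult.commute)
    finally show ?thesis .
  qed
  ultimately show ?thesis by simp
qed

lemma times_differentiable_iter_partial: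
  assumes "times_differentiable (length is + k) f"
  shows "times_differentiable k (iter_partial is f)"
  using assms
proof (induction "is" arbitrary: k)
  case (Cons i "is")
  then have "times_differentiable (Suc k) (iter_partial is f)"
    by (metis length_Cons add_Suc_shift)
  then show ?case by simp
qed simp

lemma iter_partial_differentiable:
  assumes "times_differentiable p f" and "length is < p"
  shows "iter_partial is f differentiable (at x)"
proof -
  have "p = length is + Suc (p - length is - 1)"
    using assms(2) by simp
  then have "times_differentiable (Suc (p - length is - 1)) (iter_partial is f)"
    using assms(1) by (metis times_differentiable_iter_partial)
  then show ?thesis by simp
qed

lemma deriv_form_0: "deriv_form 0 f x h = f x"
  by (simp add: deriv_form_def)

text \<open>The head of a list is the partial derivative taken last. Splitting it off leaves the
  directional derivative of each \<open>iter_partial is f\<close> along \<open>h\<close>, which is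
  what differentiating \<open>deriv_form m f\<close> along a line produces term by term.\<close>

lemma deriv_form_Suc:
  fixes f :: "real ^ 'n \<Rightarrow> real"
  shows "deriv_form (Suc m) f x h =
    (\<Sum>is\<in>{is. length is = m}. (\<Sum>i\<in>UNIV. partial i (iter_partial is f) x * h $ i) *
       (\<Prod>j<m. h $ (is ! j)))"
proof -
  have img: "{is :: 'n list. length is = Suc m} =
      (\<lambda>(is, i). i # is) ` ({is. length is = m} \<times> UNIV)"
    by (auto simp: length_Suc_conv image_iff)
  have inj: "inj_on (\<lambda>(is, i). i # is) ({is. length is = m} \<times> (UNIV :: 'n set))"
    by (auto simp: inj_on_def)
  show ?thesis
    unfolding deriv_form_def img sum.reindex[OF inj]
    by (simp add: sum.cartesian_product o_def case_prod_unfold prod.lessThan_Suc_shift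
        sum_distrib_right mult.assoc del: prod.lessThan_Suc)
qed

lemma deriv_form_1: "deriv_form 1 f x h = grad f x \<bullet> h"
  by (simp add: deriv_form_Suc grad_def inner_vec_def)

lemma deriv_form_scaleR: "deriv_form m f x (c *\<^sub>R h) = c ^ m * deriv_form m f x h"
  by (simp add: deriv_form_def prod.distrib sum_distrib_left mult.left_commute)

lemma has_real_derivative_deriv_form:
  fixes f :: "real ^ 'n \<Rightarrow> real"
  assumes "times_differentiable p f" and "m < p"
  shows "((\<lambda>t. deriv_form m f (y + t *\<^sub>R h) h) has_real_derivative
           deriv_form (Suc m) f (y + t *\<^sub>R h) h) (at t)"
  unfolding deriv_form_def[of m] deriv_form_Suc
proof (rule DERIV_sum, rule DERIV_cmult_right)
  fix "is" :: "'n list"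
  assume "is \<in> {is. length is = m}"
  then show "((\<lambda>t. iter_partial is f (y + t *\<^sub>R h)) has_real_derivative
      (\<Sum>i\<in>UNIV. partial i (iter_partial is f) (y + t *\<^sub>R h) * h $ i)) (at t)"
    using assms by (intro has_real_derivative_along_line iter_partial_differentiable) auto
qed

lemma taylor_deriv_form:
  fixes f :: "real ^ 'n \<Rightarrow> real"
  assumes "times_differentiable p f" and "0 < p"
  obtains z where "f (y + h) = (\<Sum>m<p. deriv_form m f y h / fact m) + deriv_form p f z h / fact p"
proof -
  \<comment> \<open>The redundant \<open>1\<close> and \<open>0\<close> make the claim match
    \<open>Maclaurin\<close> on the interval from 0 to 1.\<close>
  have "\<exists>t::real. 0 < t \<and> t < 1 \<and> f (y + 1 *\<^sub>R h) =
      (\<Sum>m<p. deriv_form m f (y + 0 *\<^sub>R h) h / fact m * 1 ^ m) +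
      deriv_form p f (y + t *\<^sub>R h) h / fact p * 1 ^ p"
    using assms
    by (intro Maclaurin[where diff = "\<lambda>m t. deriv_form m f (y + t *\<^sub>R h) h"])
      (auto simp: deriv_form_0 intro!: has_real_derivative_deriv_form)
  then show thesis
    using that by auto
qed

section \<open>The descent estimate\<close>

text \<open>Positivity makes the kernel trivial, and in finite dimension injectivity gives
  surjectivity, so \<open>inv B\<close> is a right inverse.\<close>

lemma pos_def_self_adjoint_inv:
  assumes "pos_def_self_adjoint B"
  shows "B (inv B s) = s"
proof -
  have lin: "linear B" and pos: "\<And>v. v \<noteq> 0 \<Longrightarrow> v \<bullet> B v > 0"
    using assms by (auto simp: pos_def_self_adjoint_def)
  have "inj B"
    unfolding linear_injective_0[OF lin] using pos by force
  with lin have "surj B"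
    by (rule linear_inj_imp_surj)
  then show ?thesis
    by (rule surj_f_inv_f)
qed

text \<open>Turns the order \<open>p\<close> bound, stated in the primal norm of an arbitrary
  vector, into one in the dual norm of the gradient.\<close>

lemma primal_norm_inv:
  assumes "pos_def_self_adjoint B"
  shows "primal_norm B (inv B s) = dual_norm B s"
  by (simp add: primal_norm_def dual_norm_def pos_def_self_adjoint_inv[OF assms] inner_commute)

lemma inner_inv_pos:
  assumes "pos_def_self_adjoint B" and "s \<noteq> 0"
  shows "s \<bullet> inv B s > 0"
proof -
  have "inv B s \<noteq> 0"
    using assms pos_def_self_adjoint_inv[OF assms(1), of s]
    by (auto simp: pos_def_self_adjoint_def linear_0)
  then have "inv B s \<bullet> B (inv B s) > 0"
    using assms(1) by (simp add: pos_def_self_adjoint_def)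
  then show ?thesis
    by (simp add: pos_def_self_adjoint_inv[OF assms(1)] inner_commute)
qed

text \<open>The exponents in strong smoothness are tuned to the step: subtracting
  \<open>m * (p - 2) / (p - 1)\<close> leaves \<open>p / (p - 1)\<close> whatever \<open>m\<close>
  is.\<close>

lemma rgd_step_size_power:
  fixes p :: nat and G e :: real
  assumes "p > 1" and "G > 0"
  shows "(e / G powr ((real p - 2) / (real p - 1))) ^ m *
           G powr (real m + (real p - real m) / (real p - 1)) =
         e ^ m * G powr (real p / (real p - 1))"
proof -
  have "real p - 1 \<noteq> 0"
    using assms(1) by simp
  then have "real m + (real p - real m) / (real p - 1) - (real p - 2) / (real p - 1) * real m =
      real p / (real p - 1)"
    by (simp add: divide_simps) (simp add: algebra_simps)
  then show ?thesis
    using assms(2)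
    by (simp add: power_divide powr_realpow[symmetric] powr_powr flip: times_divide_eq_right)
      (simp flip: powr_diff)
qed

lemma rgd_step_decrease:
  fixes f :: "real ^ 'n \<Rightarrow> real"
  assumes B: "pos_def_self_adjoint B"
    and smooth: "strongly_smooth B p L f"
    and e: "0 < \<eta> powr (1 / (real p - 1))"
      "\<eta> powr (1 / (real p - 1)) \<le> min 1 (1 / (2 * (\<Sum>m=2..p. L m / fact m)))"
  shows "f (rgd_step B p \<eta> f y) - f y \<le>
    - (\<eta> powr (1 / (real p - 1)) / 2 * dual_norm B (grad f y) powr (real p / (real p - 1)))"
proof (cases "grad f y = 0")
  case True
  then show ?thesis
    \<comment> \<open>Both sides are 0, since \<open>0 powr a = 0\<close> for every
      \<open>a\<close>.\<close>
    using B by (simp add: rgd_step_def dual_norm_def)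
next
  case False
  define u where "u = inv B (grad f y)"
  define G where "G = dual_norm B (grad f y)"
  define e where "e = \<eta> powr (1 / (real p - 1))"
  define c where "c = e / G powr ((real p - 2) / (real p - 1))"
  define Q where "Q = G powr (real p / (real p - 1))"
  define S where "S = (\<Sum>m=2..p. L m / fact m)"
  have p: "p > 1" and diff: "times_differentiable p f" and L: "\<And>m. m \<in> {1..p} \<Longrightarrow> 0 < L m"
    and low: "\<And>m. m \<in> {1..p - 1} \<Longrightarrow>
      \<bar>deriv_form m f y u\<bar> \<le> L m * G powr (real m + (real p - real m) / (real p - 1))"
    and top: "\<And>z v. \<bar>deriv_form p f z v\<bar> \<le> L p * primal_norm B v ^ p"
    using smooth by (auto simp: strongly_smooth_def u_def G_def)
  have Gu: "grad f y \<bullet> u > 0"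
    unfolding u_def using B False by (rule inner_inv_pos)
  then have G: "G > 0" and G2: "grad f y \<bullet> u = G ^ 2"
    by (simp_all add: G_def dual_norm_def u_def)
  have c: "c > 0"
    using e G by (simp add: c_def e_def)
  have Q: "Q \<ge> 0"
    by (simp add: Q_def)
  \<comment> \<open>The index set is nonempty because \<open>p > 1\<close>; positivity lets the
    bound on \<open>e\<close> be multiplied out.\<close>
  have S: "S > 0"
    unfolding S_def using p L by (intro sum_pos) auto
  have e': "0 < e" "e \<le> 1" "e * S \<le> 1 / 2"
    using e S by (auto simp: e_def S_def[symmetric] field_simps)
  have c_pow: "c ^ m * G powr (real m + (real p - real m) / (real p - 1)) = e ^ m * Q" for m
    unfolding c_def Q_def using p G by (rule rgd_step_size_power)
  \<comment> \<open>The point \<open>z\<close> is left free so that one estimate covers the middle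
    orders at \<open>y\<close> and the remainder at the Taylor point. The sign of
    \<open>(- c) ^ m\<close> is absorbed by the absolute value.\<close>
  have term_bound: "deriv_form m f z ((- c) *\<^sub>R u) / fact m \<le> e\<^sup>2 * Q * (L m / fact m)"
    if m: "m \<in> {2..p}"
      and D: "\<bar>deriv_form m f z u\<bar> \<le> L m * G powr (real m + (real p - real m) / (real p - 1))"
    for m z
  proof -
    have "deriv_form m f z ((- c) *\<^sub>R u) \<le> c ^ m * \<bar>deriv_form m f z u\<bar>"
      unfolding deriv_form_scaleR using c
      by (metis abs_ge_self abs_minus_cancel abs_mult abs_of_pos power_abs)
    also have "\<dots> \<le> c ^ m * (L m * G powr (real m + (real p - real m) / (real p - 1)))"
      using D c by (intro mult_left_mono) simp_all
    also have "\<dots> = e ^ m * (Q * L m)"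
      using c_pow[of m] by (simp add: mult.left_commute mult.commute)
    also have "\<dots> \<le> e\<^sup>2 * (Q * L m)"
      using m e' Q L[of m] by (intro mult_right_mono power_decreasing) auto
    finally show ?thesis
      by (simp add: divide_right_mono mult.assoc)
  qed
  obtain z where z: "f (y + (- c) *\<^sub>R u) = (\<Sum>m<p. deriv_form m f y ((- c) *\<^sub>R u) / fact m) +
      deriv_form p f z ((- c) *\<^sub>R u) / fact p"
    using taylor_deriv_form[OF diff, of y "(- c) *\<^sub>R u"] p by auto
  \<comment> \<open>At \<open>m = 1\<close> the exponent of \<open>G\<close> in \<open>c_pow\<close>
    is 2.\<close>
  have "c * G\<^sup>2 = e * Q"
    using c_pow[of 1] p G by simp
  then have first: "deriv_form 1 f y ((- c) *\<^sub>R u) = - (e * Q)"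
    unfolding deriv_form_1 by (simp add: G2)
  have "{..<p} = insert 0 (insert 1 {2..<p})"
    using p by auto
  then have "(\<Sum>m<p. deriv_form m f y ((- c) *\<^sub>R u) / fact m) =
      f y - e * Q + (\<Sum>m=2..<p. deriv_form m f y ((- c) *\<^sub>R u) / fact m)"
    using first by (simp add: deriv_form_0)
  also have "\<dots> \<le> f y - e * Q + (\<Sum>m=2..<p. e\<^sup>2 * Q * (L m / fact m))"
    by (intro add_left_mono sum_mono term_bound low) auto
  \<comment> \<open>At \<open>m = p\<close> the exponent collapses to \<open>p\<close> and
    \<open>u\<close> has primal norm \<open>G\<close>, so \<open>top\<close> provides the premise of
    \<open>term_bound\<close> at \<open>z\<close>.\<close>
  finally have "f (y + (- c) *\<^sub>R u) \<le> f y - e * Q + (\<Sum>m=2..<p. e\<^sup>2 * Q * (L m / fact m)) +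
      e\<^sup>2 * Q * (L p / fact p)"
    unfolding z
    using term_bound[of p z] top[of z u] p G primal_norm_inv[OF B, of "grad f y"]
    by (simp add: u_def[symmetric] G_def[symmetric] powr_realpow)
  also have "\<dots> = f y - e * Q + e\<^sup>2 * Q * S"
  proof -
    have "{2..p} = insert p {2..<p}"
      using p by auto
    then show ?thesis
      unfolding S_def by (simp add: sum_distrib_left distrib_left)
  qed
  also have "\<dots> = f y - e * Q + e * Q * (e * S)"
    by (simp add: power2_eq_square)
  also have "\<dots> \<le> f y - e * Q + e * Q * (1 / 2)"
    using e' Q by (intro add_left_mono mult_left_mono) simp_all
  finally have "f (y + (- c) *\<^sub>R u) - f y \<le> - (e / 2 * Q)"
    by (simp add: algebra_simps)
  then show ?thesis
    using False by (simp add: rgd_step_def u_def c_def e_def G_def Q_def)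
qed

theorem theorem4:
  fixes B :: "real ^ 'n \<Rightarrow> real ^ 'n"
    and f :: "real ^ 'n \<Rightarrow> real"
    and p :: nat
    and L :: "nat \<Rightarrow> real"
    and \<eta> \<delta> :: real
    and x :: "nat \<Rightarrow> real ^ 'n"
  assumes "pos_def_self_adjoint B"
    and "p > 1"
    and "strongly_smooth B p L f"
    and "\<eta> > 0"
    and "0 < \<eta> powr (1 / (real p - 1))"
    and "\<eta> powr (1 / (real p - 1)) \<le> min 1 (1 / (2 * (\<Sum>m=2..p. L m / fact m)))"
    and "\<forall>k. x (Suc k) = rgd_step B p \<eta> f (x k)"
    and "\<delta> = \<eta> powr (1 / (real p - 1)) / 2"
  shows "\<forall>k. (f (x (Suc k)) - f (x k)) / \<delta>
               \<le> - (dual_norm B (grad f (x k)) powr (real p / (real p - 1)))"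
proof
  fix k
  have "f (x (Suc k)) - f (x k) \<le>
      - (\<delta> * dual_norm B (grad f (x k)) powr (real p / (real p - 1)))"
    using rgd_step_decrease[OF assms(1,3,5,6), of "x k"] assms(7)
    unfolding assms(8) by simp
  moreover have "\<delta> > 0"
    unfolding assms(8) using assms(5) by (rule half_gt_zero)
  ultimately show "(f (x (Suc k)) - f (x k)) / \<delta>
      \<le> - (dual_norm B (grad f (x k)) powr (real p / (real p - 1)))"
    by (simp add: divide_le_eq mult.commute)
qed

end
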